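(* Let $\mathcal H$ be a real or complex Hilbert space with finite dimension $n$. Let $B$ be a positive invertible operator on $\mathcal H$ with eigenvalues (counted with multiplicity) $b_1 \geq b_2 \geq \cdots \geq b_n > 0$, and for an integer $k \geq n$ let $\{c_i\}_{i=1}^k$ be a sequence of positive numbers with $c_1 \geq c_2 \geq \cdots \geq c_k$ such that $\sum_{i=1}^k c_i = \sum_{j=1}^n b_j$. There exists a frame $\{x_i\}_{i=1}^k$ for $\mathcal H$ with $k$ vectors, having frame operator $B$ and such that $\|x_i\| = \sqrt{c_i}$ for $1 \leq i \leq k$, if and only if for each $p$ with $1 \leq p \leq n-1$, $$\sum_{i=1}^p c_i \leq \sum_{i=1}^p b_i .$$
   Context: "Positive operator" means a self-adjoint operator $B$ with $\langle Bx, x\rangle \geq 0$ for all $x \in \mathcal H$. For a finite or countably infinite index set $\mathbb J$, a collection of vectors $\{x_j\}_{j \in \mathbb J} \subset \mathcal H$ is a frame for $\mathcal H$ if there exist constants $D \geq C > 0$ such that for every $x \in \mathcal H$, $C\|x\|^2 \leq \sum_{j \in \mathbb J} |\langle x, x_j\rangle|^2 \leq D\|x\|^2$. The vectors of a frame are indexed and need not be distinct. The frame operator of a frame $\{x_j\}$ is the map $S : \mathcal H \to \mathcal H$, $Sx = \sum_j \langle x, x_j\rangle x_j$. *)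

theory Defs
  imports "HOL-Analysis.Analysis"
begin

(* The scalar fields of real and complex Hilbert spaces, treated uniformly. The axioms force the
   field to be a copy of the reals with the identity or of the complex numbers with the usual
   conjugation; see real_or_complex_cases below. *)
class real_or_complex = real_normed_field +
  fixes conjg :: "'a \<Rightarrow> 'a"
  assumes conjg_add: "conjg (x + y) = conjg x + conjg y"
    and conjg_mult: "conjg (x * y) = conjg x * conjg y"
    and conjg_conjg: "conjg (conjg x) = x"
    and mult_conjg_scaleR: "x * conjg x = (norm x)\<^sup>2 *\<^sub>R 1"

lemma mult_conjg: "x * conjg x = of_real ((norm x)\<^sup>2)" for x :: "'a::real_or_complex"
  by (simp only: mult_conjg_scaleR of_real_def)

instantiation real :: real_or_complex
begin

definition conjg_real :: "real \<Rightarrow> real"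
  where "conjg_real x = x"

instance
  by standard (simp_all add: conjg_real_def power2_eq_square)

end

instantiation complex :: real_or_complex
begin

definition conjg_complex :: "complex \<Rightarrow> complex"
  where "conjg_complex z = cnj z"

instance
  by standard (simp_all add: conjg_complex_def complex_norm_square[symmetric] scaleR_conv_of_real del: of_real_power)

end

lemma conjg_of_real [simp]: "conjg (of_real r :: 'a::real_or_complex) = of_real r"
proof (cases "r = 0")
  case True
  have "conjg (0::'a) = 0"
    using conjg_add[of "0::'a" 0] by simp
  with True show ?thesis by simp
next
  case False
  have "of_real r * conjg (of_real r :: 'a) = of_real r * of_real r"
    using mult_conjg[of "of_real r :: 'a"] by (simp add: power2_eq_square)
  with False show ?thesis by simp
qed

lemma real_or_complex_cases:
  "((\<forall>z::'a::real_or_complex. z \<in> \<real>) \<and> (\<forall>z::'a. conjg z = z)) \<or>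
   (\<exists>i::'a. i * i = - 1 \<and> conjg i = - i \<and> (\<forall>z. \<exists>a b. z = of_real a + of_real b * i))"
proof -
  have zero: "conjg (0::'a) = 0"
    using conjg_of_real[of 0, where ?'a = 'a] by simp
  have minus: "conjg (- z) = - conjg z" for z :: 'a
    using conjg_add[of z "- z"] zero by (simp add: eq_neg_iff_add_eq_0 add.commute)
  have one: "conjg (1::'a) = 1"
    using conjg_of_real[of 1, where ?'a = 'a] by simp
  have sum_real: "z + conjg z \<in> \<real>" for z :: 'a
  proof -
    have "(z + 1) * conjg (z + 1) = z * conjg z + (z + conjg z) + 1"
      by (simp add: conjg_add one algebra_simps)
    then have "z + conjg z = of_real ((norm (z + 1))\<^sup>2) - of_real ((norm z)\<^sup>2) - 1"
      by (simp add: mult_conjg algebra_simps del: of_real_power)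
    then show ?thesis by (auto intro!: Reals_diff)
  qed
  show ?thesis
  proof (cases "\<forall>z::'a. conjg z = z")
    case True
    have "z \<in> \<real>" for z :: 'a
    proof -
      have "2 * z \<in> \<real>"
        using sum_real[of z] True by (metis mult_2)
      then have "2 * z / 2 \<in> \<real>"
        by (intro Reals_divide) auto
      then show ?thesis by simp
    qed
    with True show ?thesis by blast
  next
    case False
    then obtain w :: 'a where w: "conjg w \<noteq> w" by blast
    define u where "u = w - conjg w"
    have u0: "u \<noteq> 0" using w by (simp add: u_def)
    have cu: "conjg u = - u"
      using conjg_add[of w "- conjg w"] by (simp add: u_def minus conjg_conjg)
    define i where "i = u / of_real (norm u)"
    have iu: "u = of_real (norm u) * i" using u0 by (simp add: i_def)
    have "conjg u = of_real (norm u) * conjg i"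
      by (subst iu) (simp add: conjg_mult)
    then have ci: "conjg i = - i"
      using cu u0 by (simp add: i_def field_simps)
    have ni: "norm i = 1" using u0 by (simp add: i_def norm_divide)
    have "- (i * i) = 1"
      using mult_conjg[of i] by (simp add: ci ni)
    then have ii: "i * i = - 1"
      by (metis minus_minus)
    have "\<exists>a b. z = of_real a + of_real b * i" for z :: 'a
    proof -
      obtain a where a: "z + conjg z = of_real a" using sum_real[of z] by (auto elim: Reals_cases)
      obtain b where b: "z * i + conjg (z * i) = of_real b"
        using sum_real[of "z * i"] by (auto elim: Reals_cases)
      have "(z - conjg z) * i = of_real b"
        using b by (simp add: conjg_mult ci algebra_simps)
      then have "(z - conjg z) * (i * i) = of_real b * i"
        by (simp add: mult.assoc[symmetric])
      then have "- (z - conjg z) = of_real b * i"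
        by (simp add: ii)
      then have "z - conjg z = - (of_real b * i)"
        by (metis minus_minus)
      with a have "(z + conjg z) + (z - conjg z) = of_real a - of_real b * i"
        by simp
      moreover have "2 * z = (z + conjg z) + (z - conjg z)"
        unfolding mult_2 by simp
      ultimately have "2 * z = of_real a - of_real b * i"
        by (simp only:)
      then have "2 * z / 2 = (of_real a - of_real b * i) / 2"
        by simp
      then have "z = of_real (a / 2) + of_real (- b / 2) * i"
        by (simp add: diff_divide_distrib)
      then show ?thesis by blast
    qed
    with ii ci show ?thesis by blast
  qed
qed

locale inner_product_space = vector_space scale
  for scale :: "'k::real_or_complex \<Rightarrow> 'v::ab_group_add \<Rightarrow> 'v" +
  fixes ip :: "'v \<Rightarrow> 'v \<Rightarrow> 'k"
  assumes ip_add_left: "ip (x + y) z = ip x z + ip y z"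
    and ip_scale_left: "ip (scale a x) y = a * ip x y"
    and ip_commute: "ip y x = conjg (ip x y)"
    and ip_nonneg: "ip x x \<in> \<real>\<^sub>\<ge>\<^sub>0"
    and ip_eq_0_imp: "ip x x = 0 \<Longrightarrow> x = 0"
begin

(* By ip_nonneg, the scalar norm below only converts the scalar ip x x into a real number. *)
definition vnorm :: "'v \<Rightarrow> real"
  where "vnorm x = sqrt (norm (ip x x))"

(* The finiteness conjunct matters: dim is 0 on infinite-dimensional spaces. *)
definition has_dimension :: "nat \<Rightarrow> bool"
  where "has_dimension n \<longleftrightarrow> (\<exists>A. finite A \<and> span A = UNIV) \<and> dim UNIV = n"

definition self_adjoint :: "('v \<Rightarrow> 'v) \<Rightarrow> bool"
  where "self_adjoint B \<longleftrightarrow>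
    Vector_Spaces.linear scale scale B \<and> (\<forall>x y. ip (B x) y = ip x (B y))"

definition positive_operator :: "('v \<Rightarrow> 'v) \<Rightarrow> bool"
  where "positive_operator B \<longleftrightarrow> self_adjoint B \<and> (\<forall>x. ip (B x) x \<in> \<real>\<^sub>\<ge>\<^sub>0)"

(* b 1, ..., b n lists the eigenvalues of B, each as often as the dimension of its eigenspace
   (for scalars that are not eigenvalues both sides are 0). This is used for self-adjoint B,
   where geometric and algebraic multiplicities agree. *)
definition eigenvalue_list :: "('v \<Rightarrow> 'v) \<Rightarrow> nat \<Rightarrow> (nat \<Rightarrow> real) \<Rightarrow> bool"
  where "eigenvalue_list B n b \<longleftrightarrow>
    (\<forall>\<mu>. card {j \<in> {1..n}. of_real (b j) = \<mu>} = dim {x. B x = scale \<mu> x})"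

definition is_frame :: "'i set \<Rightarrow> ('i \<Rightarrow> 'v) \<Rightarrow> bool"
  where "is_frame J X \<longleftrightarrow> countable J \<and>
    (\<exists>C D. 0 < C \<and> C \<le> D \<and>
      (\<forall>x. (\<lambda>j. (norm (ip x (X j)))\<^sup>2) summable_on J \<and>
           C * (vnorm x)\<^sup>2 \<le> (\<Sum>\<^sub>\<infinity>j\<in>J. (norm (ip x (X j)))\<^sup>2) \<and>
           (\<Sum>\<^sub>\<infinity>j\<in>J. (norm (ip x (X j)))\<^sup>2) \<le> D * (vnorm x)\<^sup>2))"

(* Unconditional convergence of the defining series in vnorm; the type of vectors carries no
   topology of its own. For finite J this is equality with the finite sum. *)
definition is_frame_operator :: "'i set \<Rightarrow> ('i \<Rightarrow> 'v) \<Rightarrow> ('v \<Rightarrow> 'v) \<Rightarrow> bool"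
  where "is_frame_operator J X S \<longleftrightarrow>
    (\<forall>x. ((\<lambda>F. vnorm ((\<Sum>j\<in>F. scale (ip x (X j)) (X j)) - S x)) \<longlongrightarrow> 0)
           (finite_subsets_at_top J))"

lemma is_frame_operator_finite:
  assumes "finite J"
  shows "is_frame_operator J X S \<longleftrightarrow> (\<forall>x. S x = (\<Sum>j\<in>J. scale (ip x (X j)) (X j)))"
proof -
  have ip_zero: "ip 0 0 = 0"
    using ip_add_left[of 0 0 0] by simp
  have lim: "((\<lambda>F. f F) \<longlongrightarrow> 0) (principal {J}) \<longleftrightarrow> f J = 0" for f :: "_ \<Rightarrow> real"
  proof
    assume "((\<lambda>F. f F) \<longlongrightarrow> 0) (principal {J})"
    moreover have "((\<lambda>F. f F) \<longlongrightarrow> f J) (principal {J})"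
      by (intro tendsto_eventually) (simp add: eventually_principal)
    moreover have "principal {J} \<noteq> bot"
      by (simp add: principal_eq_bot_iff)
    ultimately show "f J = 0"
      using tendsto_unique by blast
  next
    assume "f J = 0"
    then show "((\<lambda>F. f F) \<longlongrightarrow> 0) (principal {J})"
      by (intro tendsto_eventually) (simp add: eventually_principal)
  qed
  have "vnorm v = 0 \<longleftrightarrow> v = 0" for v
    using ip_eq_0_imp[of v] ip_zero by (auto simp: vnorm_def)
  with lim show ?thesis
    using assms unfolding is_frame_operator_def
    by (auto simp: finite_subsets_at_top_finite)
qed

end

locale hilbert_space = inner_product_space scale ip
  for scale :: "'k::real_or_complex \<Rightarrow> 'v::ab_group_add \<Rightarrow> 'v" and ip :: "'v \<Rightarrow> 'v \<Rightarrow> 'k" +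
  assumes complete:
    "(\<forall>e>0. \<exists>N. \<forall>p\<ge>N. \<forall>q\<ge>N. vnorm (X p - X q) < e) \<Longrightarrow>
     \<exists>l. (\<lambda>p::nat. vnorm (X p - l)) \<longlonglongrightarrow> 0"

end

theory Submission
  imports Defs
begin

text \<open>Everything happens in an orthonormal basis \<open>e\<^sub>1, \<dots>, e\<^sub>n\<close> of eigenvectors of \<open>B\<close>, which
  \<open>ortho_eigenfamily\<close> and \<open>ortho_family_expansion\<close> provide. In finite dimension a frame operator
  \<open>B\<close> means \<open>B y = \<Sum>\<^sub>i \<langle>y, x\<^sub>i\<rangle> x\<^sub>i\<close>.

  Given such vectors, the squared norms \<open>c\<^sub>i = \<parallel>x\<^sub>i\<parallel>\<^sup>2\<close> are obtained from the eigenvalues by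
  nonnegative weights \<open>w\<^sub>i\<^sub>j = \<bar>\<langle>x\<^sub>i, e\<^sub>j\<rangle>\<bar>\<^sup>2 / b\<^sub>j\<close>, as \<open>c\<^sub>i = \<Sum>\<^sub>j b\<^sub>j w\<^sub>i\<^sub>j\<close>. Their columns sum to 1 and their
  rows to at most 1. So \<open>c\<^sub>1 + \<dots> + c\<^sub>p\<close> spreads total weight at most \<open>p\<close> over the eigenvalues, no
  eigenvalue getting more than 1, and cannot exceed the sum of the \<open>p\<close> largest ones
  (\<open>frame_norms_prefix_le\<close>).

  Conversely, the vectors \<open>\<surd>b\<^sub>j e\<^sub>j\<close>, padded with zero vectors to a family of length \<open>k\<close>, have the right
  operator but the wrong norms. Mixing two members of a family by an orthogonal two-by-two matrix
  does not change its operator. The inequalities for partial sums, with the equal totals, say that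
  the squared norms of this family majorise \<open>c\<close>, and then the prescribed norms can be reached one vector at a time, as in the Schur--Horn
  theorem (\<open>mix_pair\<close>, \<open>prescribed_norms\<close>). The result is a frame because \<open>\<Sum>\<^sub>i \<bar>\<langle>y, x\<^sub>i\<rangle>\<bar>\<^sup>2 = \<langle>B y, y\<rangle>\<close>
  and the eigenvalues of \<open>B\<close> are positive.\<close>

section \<open>Inner products over the real or complex scalars\<close>

context inner_product_space
begin

lemma conjg_zero: "conjg (0::'k) = 0"
  using conjg_of_real[of 0, where ?'a = 'k] by simp

lemma ip_add_right: "ip z (x + y) = ip z x + ip z y"
  by (metis conjg_add ip_add_left ip_commute)

lemma ip_scale_right: "ip x (scale a y) = conjg a * ip x y"
  by (metis conjg_mult ip_scale_left ip_commute)

lemma ip_zero_left: "ip 0 x = 0"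
  using ip_add_left[of 0 0 x] by simp

lemma ip_zero_right: "ip x 0 = 0"
  using ip_add_right[of x 0 0] by simp

lemma ip_diff_left: "ip (x - y) z = ip x z - ip y z"
  using ip_add_left[of "x - y" y z] by (simp add: algebra_simps)

lemma ip_diff_right: "ip z (x - y) = ip z x - ip z y"
  using ip_add_right[of z "x - y" y] by (simp add: algebra_simps)

lemma ip_sum_left: "ip (\<Sum>i\<in>I. f i) y = (\<Sum>i\<in>I. ip (f i) y)"
  by (induction I rule: infinite_finite_induct) (simp_all add: ip_add_left ip_zero_left)

lemma ip_swap_eq_0: "ip x y = 0 \<Longrightarrow> ip y x = 0"
  by (metis conjg_zero ip_commute)

lemma ip_mult_swap: "ip x y * ip y x = of_real ((norm (ip x y))\<^sup>2)"
  using mult_conjg[of "ip x y"] ip_commute[of y x] by simp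

lemma ip_self_vnorm: "ip x x = of_real ((vnorm x)\<^sup>2)"
  using ip_nonneg[of x] unfolding vnorm_def by (elim nonneg_Reals_cases) simp

lemma vnorm_sq_eqI: "ip x x = of_real r \<Longrightarrow> (vnorm x)\<^sup>2 = r"
  by (metis ip_self_vnorm of_real_eq_iff)

lemma vnorm_nonneg: "0 \<le> vnorm x"
  by (simp add: vnorm_def)

section \<open>Orthonormal sets and orthonormal bases\<close>

definition ortho_set :: "'v set \<Rightarrow> bool"
  where "ortho_set Q \<longleftrightarrow> (\<forall>x\<in>Q. ip x x = 1) \<and> (\<forall>x\<in>Q. \<forall>y\<in>Q. x \<noteq> y \<longrightarrow> ip x y = 0)"

definition ortho_family :: "'i set \<Rightarrow> ('i \<Rightarrow> 'v) \<Rightarrow> bool"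
  where "ortho_family I e \<longleftrightarrow> (\<forall>i\<in>I. \<forall>j\<in>I. ip (e i) (e j) = (if i = j then 1 else 0))"

lemma ip_ortho_residual:
  assumes "finite I" "ortho_family I e" "j \<in> I"
  shows "ip (x - (\<Sum>i\<in>I. scale (ip x (e i)) (e i))) (e j) = 0"
proof -
  have "(\<Sum>i\<in>I. ip x (e i) * ip (e i) (e j)) = (\<Sum>i\<in>I. if i = j then ip x (e i) else 0)"
    using assms unfolding ortho_family_def by (intro sum.cong) auto
  then show ?thesis
    using assms by (simp add: ip_diff_left ip_sum_left ip_scale_left)
qed

text \<open>Gram--Schmidt, one vector at a time: as long as fewer than \<open>dim S\<close> orthonormal vectors have
  been found, some vector of \<open>S\<close> lies outside their span, and its normalised residual extends the
  set.\<close>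

lemma ortho_set_exists:
  assumes "subspace S" "d \<le> dim S"
  shows "\<exists>Q. finite Q \<and> Q \<subseteq> S \<and> card Q = d \<and> ortho_set Q"
  using assms(2)
proof (induction d)
  case 0
  show ?case by (rule exI[of _ "{}"]) (simp add: ortho_set_def)
next
  case (Suc d)
  then obtain Q where Q: "finite Q" "Q \<subseteq> S" "card Q = d" "ortho_set Q" by auto
  have "\<not> S \<subseteq> span Q"
    using dim_le_card[of S Q] Q Suc.prems by auto
  then obtain x where x: "x \<in> S" "x \<notin> span Q" by blast
  define p where "p = (\<Sum>q\<in>Q. scale (ip x q) q)"
  define y where "y = x - p"
  have "p \<in> span Q"
    unfolding p_def by (intro span_sum span_scale span_base)
  then have y0: "y \<noteq> 0" using x by (auto simp: y_def)
  have "p \<in> S"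
    unfolding p_def using Q assms(1) by (intro subspace_sum subspace_scale) auto
  then have yS: "y \<in> S"
    unfolding y_def using x assms(1) by (intro subspace_diff)
  have yq: "ip y q = 0" if "q \<in> Q" for q
    using ip_ortho_residual[of Q id q x] Q that
    by (auto simp: y_def p_def ortho_family_def ortho_set_def)
  have yy: "ip y y = of_real ((vnorm y)\<^sup>2)" by (rule ip_self_vnorm)
  have ny: "vnorm y \<noteq> 0" using yy y0 ip_eq_0_imp[of y] by auto
  define z where "z = scale (of_real (1 / vnorm y)) y"
  have zz: "ip z z = 1"
    unfolding z_def ip_scale_left ip_scale_right conjg_of_real yy
    using ny by (simp add: power2_eq_square)
  have zq: "ip z q = 0 \<and> ip q z = 0" if "q \<in> Q" for q
    using yq[OF that] ip_swap_eq_0[OF yq[OF that]] by (simp add: z_def ip_scale_left ip_scale_right)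
  have "z \<notin> Q" using zz zq by force
  moreover have "z \<in> S" unfolding z_def using yS assms(1) by (intro subspace_scale)
  moreover have "ortho_set (insert z Q)"
    using Q(4) zz zq unfolding ortho_set_def by auto
  ultimately show ?case
    using Q by (intro exI[of _ "insert z Q"]) auto
qed

lemma ortho_family_independent:
  assumes "finite I" "ortho_family I e"
  shows "inj_on e I" "independent (e ` I)"
proof -
  show inj: "inj_on e I"
  proof (rule inj_onI)
    fix i j assume "i \<in> I" "j \<in> I" "e i = e j"
    with assms(2) show "i = j"
      unfolding ortho_family_def by (metis zero_neq_one)
  qed
  show "independent (e ` I)"
  proof (rule independent_if_scalars_zero)
    show "finite (e ` I)" using assms by simp
    fix f x assume s: "(\<Sum>x\<in>e ` I. scale (f x) x) = 0" and x: "x \<in> e ` I"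
    obtain j where j: "j \<in> I" "x = e j" using x by blast
    have "0 = ip (\<Sum>i\<in>I. scale (f (e i)) (e i)) (e j)"
      using s by (simp add: sum.reindex[OF inj] ip_zero_left)
    also have "\<dots> = (\<Sum>i\<in>I. if i = j then f (e i) else 0)"
      unfolding ip_sum_left using assms j
      by (intro sum.cong) (auto simp: ip_scale_left ortho_family_def)
    finally show "f x = 0" using assms(1) j by simp
  qed
qed

lemma ortho_family_expansion:
  assumes dimn: "has_dimension n" and I: "finite I" "card I = n" and e: "ortho_family I e"
  shows "x = (\<Sum>i\<in>I. scale (ip x (e i)) (e i))"
proof -
  obtain A where A: "finite A" "span A = UNIV" and dim: "dim UNIV = n"
    using dimn unfolding has_dimension_def by blast
  obtain T where T: "independent T" "UNIV \<subseteq> span T" "card T = n"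
    using basis_exists[of UNIV] dim by metis
  have finT: "finite T"
    using independent_span_bound[of A T] A T by auto
  have indep: "independent (e ` I)" and inj: "inj_on e I"
    using ortho_family_independent[OF I(1) e] by auto
  have spn: "y \<in> span (e ` I)" for y
  proof (rule ccontr)
    assume y: "y \<notin> span (e ` I)"
    then have "independent (insert y (e ` I))"
      using indep by (simp add: independent_insert)
    then have "card (insert y (e ` I)) \<le> n"
      using independent_span_bound[OF finT] T by auto
    moreover have "y \<notin> e ` I" using y span_base by blast
    ultimately show False
      using I card_image[OF inj] by simp
  qed
  define y where "y = x - (\<Sum>i\<in>I. scale (ip x (e i)) (e i))"
  have "ip z y = 0" for z
    using spn[of z]
  proof (induction rule: span_induct_alt)
    case base
    show ?case by (rule ip_zero_left)
  next
    case (step c u v)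
    then obtain j where j: "j \<in> I" "u = e j" by blast
    have "ip u y = 0"
      unfolding j y_def using ip_ortho_residual[OF I(1) e j(1)] by (rule ip_swap_eq_0)
    with step show ?case by (simp add: ip_add_left ip_scale_left)
  qed
  then have "y = 0" by (intro ip_eq_0_imp)
  then show ?thesis by (simp add: y_def)
qed

lemma parseval:
  assumes "\<And>x. x = (\<Sum>i\<in>I. scale (ip x (e i)) (e i))"
  shows "(vnorm x)\<^sup>2 = (\<Sum>i\<in>I. (norm (ip x (e i)))\<^sup>2)"
proof -
  have "ip x x = ip (\<Sum>i\<in>I. scale (ip x (e i)) (e i)) x"
    by (rule arg_cong[where f = "\<lambda>y. ip y x", OF assms])
  also have "\<dots> = of_real (\<Sum>i\<in>I. (norm (ip x (e i)))\<^sup>2)"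
    by (simp add: ip_sum_left ip_scale_left ip_mult_swap del: of_real_power)
  finally show ?thesis by (rule vnorm_sq_eqI)
qed

text \<open>The eigenvalue list prescribes the dimension of every eigenspace, so the indices carrying a
  value \<open>\<beta>\<close> can be matched with an orthonormal system in the eigenspace of \<open>\<beta>\<close>. Vectors
  from different eigenspaces are orthogonal because \<open>B\<close> is self-adjoint.\<close>

lemma ortho_eigenfamily:
  assumes sa: "self_adjoint B" and ev: "eigenvalue_list B n b"
  shows "\<exists>e. ortho_family {1..n} e \<and> (\<forall>j\<in>{1..n}. B (e j) = scale (of_real (b j)) (e j))"
proof -
  define F where "F \<beta> = {j \<in> {1..n}. b j = \<beta>}" for \<beta>
  define E where "E \<beta> = {x. B x = scale (of_real \<beta>) x}" for \<beta> :: real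
  have lin: "Vector_Spaces.linear scale scale B"
    and sym: "\<And>x y. ip (B x) y = ip x (B y)"
    using sa unfolding self_adjoint_def by auto
  interpret lin: Vector_Spaces.linear scale scale B by (rule lin)
  have sub: "subspace (E \<beta>)" for \<beta>
    unfolding subspace_def E_def
    by (auto simp: lin.add lin.scale scale_right_distrib mult.commute)
  have dimE: "card (F \<beta>) = dim (E \<beta>)" for \<beta>
    using ev[unfolded eigenvalue_list_def, rule_format, of "of_real \<beta>"]
    by (simp only: F_def E_def of_real_eq_iff)
  have "\<exists>f. ortho_family (F \<beta>) f \<and> f ` F \<beta> \<subseteq> E \<beta>" for \<beta>
  proof -
    obtain Q where Q: "finite Q" "Q \<subseteq> E \<beta>" "card Q = card (F \<beta>)" "ortho_set Q"
      using ortho_set_exists[OF sub eq_imp_le[OF dimE]] by blast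
    then obtain f where f: "bij_betw f (F \<beta>) Q"
      using finite_same_card_bij[of "F \<beta>" Q] by (auto simp: F_def)
    then have "ortho_family (F \<beta>) f"
      using Q(4) unfolding ortho_family_def ortho_set_def bij_betw_def inj_on_def by auto blast
    moreover have "f ` F \<beta> \<subseteq> E \<beta>"
      using f Q(2) by (simp add: bij_betw_def)
    ultimately show ?thesis by blast
  qed
  then obtain f where f: "\<And>\<beta>. ortho_family (F \<beta>) (f \<beta>)" "\<And>\<beta>. f \<beta> ` F \<beta> \<subseteq> E \<beta>"
    by metis
  define e where "e j = f (b j) j" for j
  have eig: "B (e j) = scale (of_real (b j)) (e j)" if "j \<in> {1..n}" for j
    using f(2)[of "b j"] that by (auto simp: e_def E_def F_def)
  have "ip (e i) (e j) = (if i = j then 1 else 0)" if ij: "i \<in> {1..n}" "j \<in> {1..n}" for i j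
  proof (cases "b i = b j")
    case True
    then show ?thesis
      using f(1)[of "b i"] ij unfolding ortho_family_def e_def F_def by auto
  next
    case False
    have "of_real (b i) * ip (e i) (e j) = of_real (b j) * ip (e i) (e j)"
      using sym[of "e i" "e j"] eig ij by (simp add: ip_scale_left ip_scale_right)
    then have "ip (e i) (e j) = 0" using False by simp
    with False show ?thesis by auto
  qed
  with eig show ?thesis unfolding ortho_family_def by blast
qed

section \<open>Necessity: the frame vectors in the eigenbasis\<close>

lemma frame_operator_form:
  assumes "\<And>y. S y = (\<Sum>i\<in>J. scale (ip y (x i)) (x i))"
  shows "ip (S y) y = of_real (\<Sum>i\<in>J. (norm (ip y (x i)))\<^sup>2)"
  unfolding assms[of y] by (simp add: ip_sum_left ip_scale_left ip_mult_swap del: of_real_power)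

text \<open>This is \<open>\<langle>S\<^sup>-\<^sup>1 x\<^sub>i, x\<^sub>i\<rangle> \<le> 1\<close> with \<open>u = S\<^sup>-\<^sup>1 x\<^sub>i\<close>: the number \<open>t = \<langle>u, x\<^sub>i\<rangle>\<close> equals
  \<open>\<langle>S u, u\<rangle> = \<Sum>\<^sub>l \<bar>\<langle>u, x\<^sub>l\<rangle>\<bar>\<^sup>2\<close>, whose summand at \<open>l = i\<close> is \<open>t\<^sup>2\<close>.\<close>

lemma frame_vector_preimage_le_1:
  assumes S: "\<And>y. S y = (\<Sum>i\<in>J. scale (ip y (x i)) (x i))"
    and J: "finite J" "i \<in> J" and u: "S u = x i" and t: "ip u (x i) = of_real t"
  shows "t \<le> 1"
proof -
  have "of_real t = ip (S u) u"
    using t u by (metis conjg_of_real ip_commute)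
  then have "t = (\<Sum>l\<in>J. (norm (ip u (x l)))\<^sup>2)"
    using frame_operator_form[OF S, of u] by (metis of_real_eq_iff)
  moreover have "(norm (ip u (x i)))\<^sup>2 \<le> (\<Sum>l\<in>J. (norm (ip u (x l)))\<^sup>2)"
    using J by (intro member_le_sum) auto
  moreover have "(norm (ip u (x i)))\<^sup>2 = t\<^sup>2"
    by (simp add: t)
  ultimately have "t\<^sup>2 \<le> t"
    by (simp only:)
  then have "t * t \<le> t * 1"
    by (simp only: power2_eq_square mult_1_right)
  then show ?thesis
    by (cases "t \<le> 0") (auto simp: mult_le_cancel_left)
qed

end

text \<open>Moving weight to earlier entries of a decreasing sequence can only increase the weighted sum,
  so the best admissible weights are 1 on the first \<open>p\<close> entries and 0 elsewhere.\<close>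

lemma weighted_sum_le_prefix:
  fixes b W :: "nat \<Rightarrow> real"
  assumes anti: "antimono_on {1..n} b" and p: "1 \<le> p" "p \<le> n" and bp: "0 \<le> b p"
    and W: "\<And>j. j \<in> {1..n} \<Longrightarrow> 0 \<le> W j \<and> W j \<le> 1" and total: "(\<Sum>j=1..n. W j) \<le> real p"
  shows "(\<Sum>j=1..n. b j * W j) \<le> (\<Sum>j=1..p. b j)"
proof -
  define d :: "nat \<Rightarrow> real" where "d j = (if j \<le> p then 1 else 0)" for j
  have pre: "(\<Sum>j=1..n. g j * d j) = (\<Sum>j=1..p. g j)" for g :: "nat \<Rightarrow> real"
    unfolding d_def using p by (intro sum.mono_neutral_cong_right) auto
  \<comment> \<open>Measured from the threshold \<open>b p\<close>, every deviation from the optimal weights loses: the first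
    factor is nonnegative and the second nonpositive up to \<open>p\<close>, and conversely after \<open>p\<close>.\<close>
  have "(b j - b p) * (W j - d j) \<le> 0" if j: "j \<in> {1..n}" for j
  proof (cases "j \<le> p")
    case True
    then have "b p \<le> b j" using anti j p by (auto simp: monotone_on_def)
    then show ?thesis using W[OF j] True by (auto simp: d_def mult_le_0_iff)
  next
    case False
    then have "b j \<le> b p" using anti j p by (auto simp: monotone_on_def)
    then show ?thesis using W[OF j] False by (auto simp: d_def mult_le_0_iff)
  qed
  then have "(\<Sum>j=1..n. (b j - b p) * (W j - d j)) \<le> 0"
    by (intro sum_nonpos)
  moreover have "(\<Sum>j=1..n. (b j - b p) * (W j - d j)) =
      (\<Sum>j=1..n. b j * W j) - (\<Sum>j=1..n. b j * d j)
      - b p * (\<Sum>j=1..n. W j) + b p * (\<Sum>j=1..n. 1 * d j)"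
    by (simp add: algebra_simps sum.distrib sum_subtractf sum_distrib_left)
  moreover have "b p * (\<Sum>j=1..n. W j) \<le> b p * real p"
    using total bp by (intro mult_left_mono)
  ultimately show ?thesis
    unfolding pre by simp
qed

context inner_product_space
begin

text \<open>The numbers \<open>w\<^sub>i\<^sub>j = \<bar>\<langle>x\<^sub>i, e\<^sub>j\<rangle>\<bar>\<^sup>2 / b\<^sub>j\<close> satisfy \<open>\<Sum>\<^sub>j b\<^sub>j w\<^sub>i\<^sub>j = \<parallel>x\<^sub>i\<parallel>\<^sup>2\<close>. Each column sums to 1, since
  \<open>\<langle>B e\<^sub>j, e\<^sub>j\<rangle> = b\<^sub>j\<close>, and each row sums to \<open>\<langle>B\<^sup>-\<^sup>1 x\<^sub>i, x\<^sub>i\<rangle> \<le> 1\<close>. The first \<open>p\<close> rows therefore put weights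
  in \<open>[0, 1]\<close> of total mass at most \<open>p\<close> on the eigenvalues.\<close>

lemma frame_norms_prefix_le:
  fixes x :: "nat \<Rightarrow> 'v" and b :: "nat \<Rightarrow> real"
  assumes ortho: "ortho_family {1..n} e"
    and expand: "\<And>y. y = (\<Sum>j=1..n. scale (ip y (e j)) (e j))"
    and lin: "Vector_Spaces.linear scale scale B"
    and eig: "\<And>j. j \<in> {1..n} \<Longrightarrow> B (e j) = scale (of_real (b j)) (e j)"
    and anti: "antimono_on {1..n} b" and pos: "\<And>j. j \<in> {1..n} \<Longrightarrow> 0 < b j"
    and Bx: "\<And>y. B y = (\<Sum>i=1..k. scale (ip y (x i)) (x i))"
    and p: "1 \<le> p" "p \<le> n" "n \<le> k"
  shows "(\<Sum>i=1..p. (vnorm (x i))\<^sup>2) \<le> (\<Sum>i=1..p. b i)"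
proof -
  interpret lin: Vector_Spaces.linear scale scale B by (rule lin)
  define w where "w i j = (norm (ip (x i) (e j)))\<^sup>2 / b j" for i j
  have w0: "0 \<le> w i j" if "j \<in> {1..n}" for i j
    using pos[OF that] by (simp add: w_def)
  have col: "(\<Sum>i=1..k. w i j) = 1" if j: "j \<in> {1..n}" for j
  proof -
    have nsym: "norm (ip (e j) (x i)) = norm (ip (x i) (e j))" for i
    proof -
      have "(of_real ((norm (ip (e j) (x i)))\<^sup>2) :: 'k) = of_real ((norm (ip (x i) (e j)))\<^sup>2)"
        by (metis ip_mult_swap mult.commute)
      then show ?thesis
        by (simp only: of_real_eq_iff power2_eq_iff_nonneg norm_ge_zero)
    qed
    have "of_real (b j) = ip (B (e j)) (e j)"
      using eig[OF j] ortho j by (simp add: ip_scale_left ortho_family_def)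
    also have "\<dots> = of_real (\<Sum>i=1..k. (norm (ip (e j) (x i)))\<^sup>2)"
      by (rule frame_operator_form[OF Bx])
    finally have "b j = (\<Sum>i=1..k. (norm (ip (x i) (e j)))\<^sup>2)"
      by (simp only: of_real_eq_iff nsym)
    then show ?thesis
      using pos[OF j] by (simp add: w_def sum_divide_distrib[symmetric])
  qed
  have row: "(\<Sum>j=1..n. w i j) \<le> 1" if i: "i \<in> {1..k}" for i
  proof (rule frame_vector_preimage_le_1[OF Bx])
    define u where "u = (\<Sum>j=1..n. scale (ip (x i) (e j) / of_real (b j)) (e j))"
    have "B u = (\<Sum>j=1..n. scale (ip (x i) (e j) / of_real (b j)) (scale (of_real (b j)) (e j)))"
      unfolding u_def using eig by (simp add: lin.sum lin.scale)
    also have "\<dots> = (\<Sum>j=1..n. scale (ip (x i) (e j)) (e j))"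
      using pos by (intro sum.cong) (auto simp: less_imp_neq[symmetric])
    finally show "B u = x i" by (simp only: expand[of "x i", symmetric])
    have "ip u (x i) = (\<Sum>j=1..n. (ip (x i) (e j) * ip (e j) (x i)) / of_real (b j))"
      by (simp add: u_def ip_sum_left ip_scale_left)
    then show "ip u (x i) = of_real (\<Sum>j=1..n. w i j)"
      by (simp add: ip_mult_swap w_def del: of_real_power)
  qed (use i in auto)
  have norms: "(vnorm (x i))\<^sup>2 = (\<Sum>j=1..n. b j * w i j)" for i
    unfolding parseval[OF expand] w_def using pos
    by (intro sum.cong) (auto simp: less_imp_neq[symmetric])
  have "(\<Sum>i=1..p. (vnorm (x i))\<^sup>2) = (\<Sum>j=1..n. b j * (\<Sum>i=1..p. w i j))"
    unfolding norms by (subst sum.swap) (simp add: sum_distrib_left)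
  also have "\<dots> \<le> (\<Sum>j=1..p. b j)"
  proof (rule weighted_sum_le_prefix[OF anti p(1,2)])
    show "0 \<le> b p" using pos[of p] p by simp
    show "0 \<le> (\<Sum>i=1..p. w i j) \<and> (\<Sum>i=1..p. w i j) \<le> 1" if j: "j \<in> {1..n}" for j
    proof
      show "0 \<le> (\<Sum>i=1..p. w i j)" using w0[OF j] by (intro sum_nonneg) auto
      have "(\<Sum>i=1..p. w i j) \<le> (\<Sum>i=1..k. w i j)"
        using w0[OF j] p by (intro sum_mono2) auto
      then show "(\<Sum>i=1..p. w i j) \<le> 1" using col[OF j] by simp
    qed
    have "(\<Sum>j=1..n. \<Sum>i=1..p. w i j) = (\<Sum>i=1..p. \<Sum>j=1..n. w i j)"
      by (rule sum.swap)
    also have "\<dots> \<le> (\<Sum>i=1..p. 1)"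
      using row p by (intro sum_mono) auto
    finally show "(\<Sum>j=1..n. \<Sum>i=1..p. w i j) \<le> real p" by simp
  qed
  finally show ?thesis .
qed

end

section \<open>Sufficiency: prescribing norms by mixing pairs of vectors\<close>

text \<open>Used both for vectors and for their squared norms: the family that is left when the neighbours
  at \<open>r\<close> and \<open>Suc r\<close> are mixed and one of the two resulting entries is taken out.\<close>

definition merge_at :: "nat \<Rightarrow> 'a \<Rightarrow> (nat \<Rightarrow> 'a) \<Rightarrow> nat \<Rightarrow> 'a"
  where "merge_at r z g i = (if i < r then g i else if i = r then z else g (Suc i))"

lemma sum_merge_at_below: "p \<le> r \<Longrightarrow> (\<Sum>i<p. merge_at r z g i) = (\<Sum>i<p. g i)"
  by (intro sum.cong) (auto simp: merge_at_def)

lemma sum_merge_at: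
  fixes g :: "nat \<Rightarrow> 'a::ab_group_add"
  assumes "r < p" "z + y = g r + g (Suc r)"
  shows "(\<Sum>i<p. merge_at r z g i) + y = (\<Sum>i<Suc p. g i)"
  using assms(1)
proof (induction p)
  case (Suc p)
  show ?case
  proof (cases "r = p")
    case True
    then show ?thesis
      using sum_merge_at_below[of p r z g] assms(2) by (simp add: merge_at_def add.assoc)
  next
    case False
    then have "(\<Sum>i<p. merge_at r z g i) + y = (\<Sum>i<Suc p. g i)" and "r < p"
      using Suc by auto
    then show ?thesis
      by (simp add: merge_at_def algebra_simps)
  qed
qed simp

lemma antimono_merge_at:
  fixes a :: "nat \<Rightarrow> real"
  assumes "antimono_on {..<Suc m} a" "r < m" "a (Suc r) \<le> z" "z \<le> a r"
  shows "antimono_on {..<m} (merge_at r z a)"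
proof (rule monotone_onI)
  have a: "a j \<le> a i" if "i \<le> j" "j \<le> m" for i j
    using assms(1) that by (auto simp: monotone_on_def)
  fix i j assume "i \<in> {..<m}" "j \<in> {..<m}" "i \<le> j"
  then show "merge_at r z a i \<ge> merge_at r z a j"
    using assms(2-4) a[of i j] a[of i r] a[of i "Suc j"] a[of "Suc r" "Suc j"] a[of "Suc i" "Suc j"]
    by (auto simp: merge_at_def)
qed

lemma crossing_index:
  fixes a :: "nat \<Rightarrow> real"
  assumes "t \<le> a 0" "a m \<le> t" "0 < m"
  shows "\<exists>r<m. a (Suc r) \<le> t \<and> t \<le> a r"
  using assms
proof (induction m)
  case (Suc m)
  then show ?case
    by (cases "m = 0"; cases "a m \<le> t") (auto intro: less_SucI)
qed simp

context inner_product_space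
begin

text \<open>Take \<open>w = p v1 + q v2\<close> and \<open>u = q v1 - p v2\<close> with real \<open>p\<^sup>2 + q\<^sup>2 = 1\<close>. The coefficient matrix is
  orthogonal, so the pair keeps its operator, and since \<open>v1\<close> and \<open>v2\<close> are orthogonal, the squared
  norm of \<open>w\<close> is the convex combination \<open>p\<^sup>2 a1 + q\<^sup>2 a2\<close>, which can be made any \<open>t\<close> between \<open>a2\<close> and
  \<open>a1\<close>. That \<open>u\<close> is a combination of \<open>v1\<close> and \<open>v2\<close> is recorded because it makes \<open>u\<close> orthogonal to
  every vector orthogonal to both.\<close>

lemma mix_pair:
  assumes v1: "ip v1 v1 = of_real a1" and v2: "ip v2 v2 = of_real a2" and orth: "ip v1 v2 = 0"
    and t: "a2 \<le> t" "t \<le> a1"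
  shows "\<exists>\<alpha> \<beta> w u. u = scale \<alpha> v1 - scale \<beta> v2 \<and> ip w w = of_real t \<and> ip u u = of_real (a1 + a2 - t) \<and>
    (\<forall>y. scale (ip y u) u + scale (ip y w) w = scale (ip y v1) v1 + scale (ip y v2) v2)"
proof -
  obtain s where s: "0 \<le> s" "s \<le> 1" "s * a1 + (1 - s) * a2 = t"
  proof (cases "a1 = a2")
    case True
    then show ?thesis using t that[of 0] by simp
  next
    case False
    then have d: "0 < a1 - a2" using t by simp
    define s where "s = (t - a2) / (a1 - a2)"
    have "s * (a1 - a2) = t - a2" using d by (simp add: s_def)
    then have "s * a1 + (1 - s) * a2 = t" by (simp add: algebra_simps)
    moreover have "0 \<le> s" "s \<le> 1" using d t by (auto simp: s_def divide_le_eq_1)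
    ultimately show ?thesis by (rule that[rotated 2])
  qed
  define p q :: 'k where "p = of_real (sqrt s)" and "q = of_real (sqrt (1 - s))"
  have pp: "p * p = of_real s" and qq: "q * q = of_real (1 - s)"
    unfolding p_def q_def of_real_mult[symmetric] using s by simp_all
  have cp: "conjg p = p" "conjg q = q" by (simp_all add: p_def q_def)
  define w u where "w = scale p v1 + scale q v2" and "u = scale q v1 - scale p v2"
  note ips = ip_add_left ip_add_right ip_diff_left ip_diff_right ip_scale_left ip_scale_right
    v1 v2 orth ip_swap_eq_0[OF orth] cp
  have "ip w w = (p * p) * of_real a1 + (q * q) * of_real a2"
    by (simp add: w_def ips algebra_simps)
  also have "\<dots> = of_real t" unfolding pp qq s(3)[symmetric] by simp
  finally have ww: "ip w w = of_real t" .
  have "ip u u = (q * q) * of_real a1 + (p * p) * of_real a2"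
    by (simp add: u_def ips algebra_simps)
  also have "\<dots> = of_real (a1 + a2 - t)"
    unfolding pp qq s(3)[symmetric] by (simp add: algebra_simps)
  finally have uu: "ip u u = of_real (a1 + a2 - t)" .
  have op: "scale (ip y u) u + scale (ip y w) w = scale (ip y v1) v1 + scale (ip y v2) v2" for y
  proof -
    have one: "p * p + q * q = 1" unfolding pp qq by simp
    have "scale (ip y u) u + scale (ip y w) w =
        scale ((p * p + q * q) * ip y v1) v1 + scale ((p * p + q * q) * ip y v2) v2"
      unfolding u_def w_def
      by (simp add: ips scale_right_distrib scale_right_diff_distrib scale_left_distrib
          scale_left_diff_distrib algebra_simps)
    then show ?thesis by (simp add: one)
  qed
  show ?thesis
    using u_def ww uu op by blast
qed

text \<open>The operator form of the Schur--Horn theorem. For \<open>k \<ge> 2\<close>, majorisation forces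
  \<open>a 0 \<ge> c 0 \<ge> a (k - 1)\<close>, so \<open>c 0\<close> lies between two neighbouring squared norms \<open>a r\<close> and \<open>a (Suc r)\<close>. Mixing these two vectors
  produces one vector of squared norm \<open>c 0\<close>, which is kept, and one of squared norm
  \<open>a r + a (Suc r) - c 0\<close>, which is still orthogonal to all remaining ones. The latter value lies
  between \<open>a (Suc r)\<close> and \<open>a r\<close>, so the remaining norms stay decreasing; they majorise \<open>c 1, c 2, \<dots>\<close>.\<close>

lemma prescribed_norms:
  fixes a c :: "nat \<Rightarrow> real" and v :: "nat \<Rightarrow> 'v"
  assumes "antimono_on {..<k} a" "antimono_on {..<k} c"
    and "\<And>p. p \<le> k \<Longrightarrow> (\<Sum>i<p. c i) \<le> (\<Sum>i<p. a i)"
    and "(\<Sum>i<k. c i) = (\<Sum>i<k. a i)"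
    and "\<And>i j. i < k \<Longrightarrow> j < k \<Longrightarrow> ip (v i) (v j) = (if i = j then of_real (a i) else 0)"
  shows "\<exists>x. (\<forall>i<k. ip (x i) (x i) = of_real (c i)) \<and>
    (\<forall>y. (\<Sum>i<k. scale (ip y (x i)) (x i)) = (\<Sum>i<k. scale (ip y (v i)) (v i)))"
  using assms
proof (induction k arbitrary: a c v)
  case 0
  then show ?case by simp
next
  case (Suc m)
  note anti_a = Suc.prems(1) and anti_c = Suc.prems(2) and maj = Suc.prems(3)
    and total = Suc.prems(4) and gram = Suc.prems(5)
  show ?case
  proof (cases "m = 0")
    case True
    then show ?thesis
      using total gram[of 0 0] by (intro exI[of _ v]) simp
  next
    case False
    have c_anti: "c j \<le> c i" if "i \<le> j" "j \<le> m" for i j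
      using anti_c that by (auto simp: monotone_on_def)
    have a_anti: "a j \<le> a i" if "i \<le> j" "j \<le> m" for i j
      using anti_a that by (auto simp: monotone_on_def)
    have "c 0 \<le> a 0" using maj[of 1] by simp
    moreover have "a m \<le> c 0"
      using maj[of m] total c_anti[of 0 m] by simp
    ultimately obtain r where r: "r < m" "a (Suc r) \<le> c 0" "c 0 \<le> a r"
      using crossing_index[of "c 0" a m] False by auto
    obtain \<alpha> \<beta> w u where u: "u = scale \<alpha> (v r) - scale \<beta> (v (Suc r))"
      and ww: "ip w w = of_real (c 0)" and uu: "ip u u = of_real (a r + a (Suc r) - c 0)"
      and op: "\<And>y. scale (ip y u) u + scale (ip y w) w
        = scale (ip y (v r)) (v r) + scale (ip y (v (Suc r))) (v (Suc r))"
      using mix_pair[of "v r" "a r" "v (Suc r)" "a (Suc r)" "c 0"] gram r by auto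
    define z where "z = a r + a (Suc r) - c 0"
    define a' where "a' = merge_at r z a"
    define v' where "v' = merge_at r u v"
    have "\<exists>x. (\<forall>i<m. ip (x i) (x i) = of_real (c (Suc i))) \<and>
      (\<forall>y. (\<Sum>i<m. scale (ip y (x i)) (x i)) = (\<Sum>i<m. scale (ip y (v' i)) (v' i)))"
    proof (rule Suc.IH)
      show "antimono_on {..<m} a'"
        unfolding a'_def using anti_a r by (intro antimono_merge_at) (auto simp: z_def)
      show "antimono_on {..<m} (\<lambda>i. c (Suc i))"
        using c_anti by (auto simp: monotone_on_def)
      have shift: "(\<Sum>i<p. c (Suc i)) + c 0 = (\<Sum>i<Suc p. c i)" for p
        by (simp add: sum.lessThan_Suc_shift del: sum.lessThan_Suc)
      have merged: "(\<Sum>i<p. a' i) + c 0 = (\<Sum>i<Suc p. a i)" if "r < p" for p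
        unfolding a'_def using that by (intro sum_merge_at) (simp_all add: z_def)
      show "(\<Sum>i<p. c (Suc i)) \<le> (\<Sum>i<p. a' i)" if p: "p \<le> m" for p
      proof (cases "r < p")
        case True
        then show ?thesis
          using shift[of p] merged[of p] maj[of "Suc p"] p by linarith
      next
        case False
        \<comment> \<open>Before the merged entry the comparison is termwise: \<open>c (Suc i) \<le> c 0 \<le> a r \<le> a i\<close>.\<close>
        have "(\<Sum>i<p. c (Suc i)) \<le> (\<Sum>i<p. a i)"
        proof (rule sum_mono)
          fix i assume "i \<in> {..<p}"
          then show "c (Suc i) \<le> a i"
            using c_anti[of 0 "Suc i"] a_anti[of i r] False r p by auto
        qed
        then show ?thesis
          using False by (simp add: a'_def sum_merge_at_below)
      qed
      show "(\<Sum>i<m. c (Suc i)) = (\<Sum>i<m. a' i)"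
        using shift[of m] merged[of m] r total by linarith
      have uv: "ip u (v j) = 0" "ip (v j) u = 0" if "j \<le> m" "j \<noteq> r" "j \<noteq> Suc r" for j
      proof -
        show "ip u (v j) = 0"
          using gram[of r j] gram[of "Suc r" j] that r
          by (auto simp: u ip_diff_left ip_scale_left)
        then show "ip (v j) u = 0" by (rule ip_swap_eq_0)
      qed
      show "ip (v' i) (v' j) = (if i = j then of_real (a' i) else 0)" if "i < m" "j < m" for i j
        using that gram uu uv by (auto simp: v'_def a'_def merge_at_def z_def)
    qed
    then obtain x where x: "\<And>i. i < m \<Longrightarrow> ip (x i) (x i) = of_real (c (Suc i))"
      and xop: "\<And>y. (\<Sum>i<m. scale (ip y (x i)) (x i)) = (\<Sum>i<m. scale (ip y (v' i)) (v' i))"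
      by blast
    define X where "X = case_nat w x"
    have "ip (X i) (X i) = of_real (c i)" if "i < Suc m" for i
      using that x ww by (cases i) (auto simp: X_def)
    moreover have "(\<Sum>i<Suc m. scale (ip y (X i)) (X i)) = (\<Sum>i<Suc m. scale (ip y (v i)) (v i))" for y
    proof -
      have "(\<Sum>i<Suc m. scale (ip y (X i)) (X i))
          = (\<Sum>i<m. scale (ip y (x i)) (x i)) + scale (ip y w) w"
        by (simp add: sum.lessThan_Suc_shift X_def add.commute del: sum.lessThan_Suc)
      also have "(\<Sum>i<m. scale (ip y (x i)) (x i))
          = (\<Sum>i<m. merge_at r (scale (ip y u) u) (\<lambda>i. scale (ip y (v i)) (v i)) i)"
        unfolding xop v'_def by (intro sum.cong) (auto simp: merge_at_def)
      also have "\<dots> + scale (ip y w) w = (\<Sum>i<Suc m. scale (ip y (v i)) (v i))"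
        using r(1) op by (rule sum_merge_at)
      finally show ?thesis .
    qed
    ultimately show ?thesis by blast
  qed
qed

text \<open>The construction starts from the orthogonal vectors \<open>\<surd>b\<^sub>j e\<^sub>j\<close>, whose operator is \<open>B\<close>, padded with
  zero vectors up to length \<open>k\<close>. Prefixes of length at least \<open>n\<close> exhaust all of \<open>b\<close>, so positivity of \<open>c\<close>
  and the equality of the totals supply the majorisation there.\<close>

lemma prescribed_norms_of_operator:
  fixes b c :: "nat \<Rightarrow> real"
  assumes ortho: "ortho_family {1..n} e"
    and Be: "\<And>y. B y = (\<Sum>j=1..n. scale (of_real (b j) * ip y (e j)) (e j))"
    and anti_b: "antimono_on {1..n} b" and pos_b: "\<And>j. j \<in> {1..n} \<Longrightarrow> 0 < b j"
    and anti_c: "antimono_on {1..k} c" and pos_c: "\<And>i. i \<in> {1..k} \<Longrightarrow> 0 < c i"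
    and nk: "n \<le> k" and total: "(\<Sum>i=1..k. c i) = (\<Sum>j=1..n. b j)"
    and maj: "\<And>p. 1 \<le> p \<Longrightarrow> p \<le> n - 1 \<Longrightarrow> (\<Sum>i=1..p. c i) \<le> (\<Sum>i=1..p. b i)"
  shows "\<exists>x. (\<forall>i\<in>{1..k}. (vnorm (x i))\<^sup>2 = c i) \<and>
    (\<forall>y. B y = (\<Sum>i=1..k. scale (ip y (x i)) (x i)))"
proof -
  have shift: "(\<Sum>i=1..p. g i) = (\<Sum>i<p. g (Suc i))" for p and g :: "nat \<Rightarrow> 'z::comm_monoid_add"
    by (simp add: sum.atLeast1_atMost_eq)
  define a where "a i = (if i < n then b (Suc i) else 0)" for i
  define v where "v i = (if i < n then scale (of_real (sqrt (b (Suc i)))) (e (Suc i)) else 0)" for i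
  have bS: "0 < b (Suc i)" if "i < n" for i using pos_b[of "Suc i"] that by simp
  have sum_a: "(\<Sum>i<p. a i) = (\<Sum>i=1..p. b i)" if "p \<le> n" for p
    using that unfolding shift by (intro sum.cong) (auto simp: a_def)
  have sum_a': "(\<Sum>i<p. a i) = (\<Sum>i=1..n. b i)" if "n \<le> p" for p
    using that unfolding shift a_def by (intro sum.mono_neutral_cong_right) auto
  have "\<exists>x. (\<forall>i<k. ip (x i) (x i) = of_real (c (Suc i))) \<and>
    (\<forall>y. (\<Sum>i<k. scale (ip y (x i)) (x i)) = (\<Sum>i<k. scale (ip y (v i)) (v i)))"
  proof (rule prescribed_norms)
    show "antimono_on {..<k} a"
      using anti_b less_imp_le[OF bS] by (auto simp: monotone_on_def a_def)
    show "antimono_on {..<k} (\<lambda>i. c (Suc i))"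
      using anti_c by (auto simp: monotone_on_def)
    show "(\<Sum>i<k. c (Suc i)) = (\<Sum>i<k. a i)"
      using total sum_a'[OF nk] by (simp add: shift[of c k] del: One_nat_def)
    show "(\<Sum>i<p. c (Suc i)) \<le> (\<Sum>i<p. a i)" if p: "p \<le> k" for p
    proof (cases "n \<le> p")
      case True
      have "(\<Sum>i=1..p. c i) \<le> (\<Sum>i=1..k. c i)"
        using p pos_c by (intro sum_mono2) (auto intro!: less_imp_le)
      then show ?thesis
        using total sum_a'[OF True] by (simp add: shift[of c] del: One_nat_def)
    next
      case False
      then show ?thesis
        using maj[of p] sum_a[of p] by (cases "p = 0") (auto simp: shift[of c] simp del: One_nat_def)
    qed
    show "ip (v i) (v j) = (if i = j then of_real (a i) else 0)" if "i < k" "j < k" for i j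
    proof (cases "i < n \<and> j < n")
      case True
      then have e: "ip (e (Suc i)) (e (Suc j)) = (if i = j then 1 else 0)"
        using ortho by (auto simp: ortho_family_def)
      have "(of_real (sqrt (b (Suc i))) * of_real (sqrt (b (Suc i))) :: 'k) = of_real (b (Suc i))"
        unfolding of_real_mult[symmetric] using bS True by (simp add: less_imp_le)
      then show ?thesis
        using True e by (auto simp: v_def a_def ip_scale_left ip_scale_right)
    next
      case False
      then show ?thesis by (auto simp: v_def a_def ip_zero_left ip_zero_right)
    qed
  qed
  then obtain x where x: "\<And>i. i < k \<Longrightarrow> ip (x i) (x i) = of_real (c (Suc i))"
    and xop: "\<And>y. (\<Sum>i<k. scale (ip y (x i)) (x i)) = (\<Sum>i<k. scale (ip y (v i)) (v i))"
    by blast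
  have vop: "(\<Sum>i<k. scale (ip y (v i)) (v i)) = B y" for y
  proof -
    have "(\<Sum>i<k. scale (ip y (v i)) (v i))
        = (\<Sum>i<n. scale (of_real (b (Suc i)) * ip y (e (Suc i))) (e (Suc i)))"
    proof (rule sum.mono_neutral_cong_right)
      fix i assume "i \<in> {..<n}"
      then have i: "i < n" by simp
      have "(of_real (sqrt (b (Suc i))) * of_real (sqrt (b (Suc i))) :: 'k) = of_real (b (Suc i))"
        unfolding of_real_mult[symmetric] using bS[OF i] by (simp add: less_imp_le)
      then show "scale (ip y (v i)) (v i) = scale (of_real (b (Suc i)) * ip y (e (Suc i))) (e (Suc i))"
        using i by (simp add: v_def ip_scale_right ac_simps)
    qed (use nk in \<open>auto simp: v_def\<close>)
    then show ?thesis unfolding Be[of y] shift by simp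
  qed
  define X where "X i = x (i - 1)" for i
  have "(vnorm (X i))\<^sup>2 = c i" if "i \<in> {1..k}" for i
    using x[of "i - 1"] that by (intro vnorm_sq_eqI) (auto simp: X_def)
  moreover have "B y = (\<Sum>i=1..k. scale (ip y (X i)) (X i))" for y
    using xop[of y] vop[of y] unfolding shift by (simp add: X_def)
  ultimately show ?thesis by blast
qed

text \<open>Since \<open>\<Sum>\<^sub>i \<bar>\<langle>y, x\<^sub>i\<rangle>\<bar>\<^sup>2 = \<langle>B y, y\<rangle> = \<Sum>\<^sub>j b\<^sub>j \<bar>\<langle>y, e\<^sub>j\<rangle>\<bar>\<^sup>2\<close>, bounds on the eigenvalues are frame
  bounds.\<close>

lemma is_frame_of_diagonal_operator:
  fixes b :: "nat \<Rightarrow> real"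
  assumes expand: "\<And>y. y = (\<Sum>j=1..n. scale (ip y (e j)) (e j))"
    and Be: "\<And>y. B y = (\<Sum>j=1..n. scale (of_real (b j) * ip y (e j)) (e j))"
    and pos: "\<And>j. j \<in> {1..n} \<Longrightarrow> 0 < b j"
    and J: "finite J" and Bx: "\<And>y. B y = (\<Sum>i\<in>J. scale (ip y (x i)) (x i))"
  shows "is_frame J x"
proof -
  \<comment> \<open>The value 1 keeps the minimum and maximum over a nonempty set in dimension 0.\<close>
  define C where "C = Min (insert 1 (b ` {1..n}))"
  define D where "D = Max (insert 1 (b ` {1..n}))"
  have C0: "0 < C" unfolding C_def using pos by (subst Min_gr_iff) auto
  have "C \<le> 1" "1 \<le> D" by (simp_all add: C_def D_def)
  then have CD: "C \<le> D" by linarith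
  have bnd: "C \<le> b j" "b j \<le> D" if "j \<in> {1..n}" for j
    unfolding C_def D_def using that by (intro Min_le Max_ge; simp)+
  have form: "(\<Sum>i\<in>J. (norm (ip y (x i)))\<^sup>2) = (\<Sum>j=1..n. b j * (norm (ip y (e j)))\<^sup>2)" for y
  proof -
    have "of_real (\<Sum>i\<in>J. (norm (ip y (x i)))\<^sup>2) = ip (B y) y"
      by (rule frame_operator_form[OF Bx, symmetric])
    also have "\<dots> = of_real (\<Sum>j=1..n. b j * (norm (ip y (e j)))\<^sup>2)"
      unfolding Be[of y]
      by (simp add: ip_sum_left ip_scale_left mult.assoc ip_mult_swap del: of_real_power)
    finally show ?thesis by (simp only: of_real_eq_iff)
  qed
  have "C * (vnorm y)\<^sup>2 \<le> (\<Sum>j=1..n. b j * (norm (ip y (e j)))\<^sup>2)"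
    "(\<Sum>j=1..n. b j * (norm (ip y (e j)))\<^sup>2) \<le> D * (vnorm y)\<^sup>2" for y
    unfolding parseval[OF expand] sum_distrib_left
    using bnd by (auto intro!: sum_mono mult_right_mono)
  with J C0 CD have "countable J \<and> 0 < C \<and> C \<le> D \<and>
      (\<forall>y. (\<lambda>i. (norm (ip y (x i)))\<^sup>2) summable_on J \<and>
        C * (vnorm y)\<^sup>2 \<le> (\<Sum>\<^sub>\<infinity>i\<in>J. (norm (ip y (x i)))\<^sup>2) \<and>
        (\<Sum>\<^sub>\<infinity>i\<in>J. (norm (ip y (x i)))\<^sup>2) \<le> D * (vnorm y)\<^sup>2)"
    by (simp add: form countable_finite)
  then show ?thesis
    unfolding is_frame_def by blast
qed

end

section \<open>The characterisation\<close>

theorem corollary4: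
  fixes scale :: "'k::real_or_complex \<Rightarrow> 'v::ab_group_add \<Rightarrow> 'v"
    and ip :: "'v \<Rightarrow> 'v \<Rightarrow> 'k"
    and B :: "'v \<Rightarrow> 'v"
    and b c :: "nat \<Rightarrow> real"
    and n k :: nat
  assumes "hilbert_space scale ip"
    and "inner_product_space.has_dimension scale n"
    and "inner_product_space.positive_operator scale ip B"
    and "bij B"
    and "inner_product_space.eigenvalue_list scale B n b"
    and "antimono_on {1..n} b"
    and "\<forall>j\<in>{1..n}. 0 < b j"
    and "n \<le> k"
    and "\<forall>i\<in>{1..k}. 0 < c i"
    and "antimono_on {1..k} c"
    and "(\<Sum>i=1..k. c i) = (\<Sum>j=1..n. b j)"
  shows "(\<exists>x :: nat \<Rightarrow> 'v.
            inner_product_space.is_frame ip {1..k} x \<and>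
            inner_product_space.is_frame_operator scale ip {1..k} x B \<and>
            (\<forall>i\<in>{1..k}. inner_product_space.vnorm ip (x i) = sqrt (c i)))
         \<longleftrightarrow> (\<forall>p. 1 \<le> p \<and> p \<le> n - 1 \<longrightarrow> (\<Sum>i=1..p. c i) \<le> (\<Sum>i=1..p. b i))"
    (is "?frame \<longleftrightarrow> ?maj")
proof -
  interpret hilbert_space scale ip by (rule assms(1))
  have sa: "self_adjoint B" using assms(3) by (simp add: positive_operator_def)
  then have lin: "Vector_Spaces.linear scale scale B" by (simp add: self_adjoint_def)
  interpret lin: Vector_Spaces.linear scale scale B by (rule lin)
  obtain e where e: "ortho_family {1..n} e"
    and eig: "\<And>j. j \<in> {1..n} \<Longrightarrow> B (e j) = scale (of_real (b j)) (e j)"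
    using ortho_eigenfamily[OF sa assms(5)] by blast
  have expand: "y = (\<Sum>j=1..n. scale (ip y (e j)) (e j))" for y
    using ortho_family_expansion[OF assms(2) _ _ e] by simp
  have Be: "B y = (\<Sum>j=1..n. scale (of_real (b j) * ip y (e j)) (e j))" for y
  proof -
    have "B y = B (\<Sum>j=1..n. scale (ip y (e j)) (e j))"
      by (rule arg_cong[OF expand])
    also have "\<dots> = (\<Sum>j=1..n. scale (of_real (b j) * ip y (e j)) (e j))"
      using eig by (simp add: lin.sum lin.scale mult.commute)
    finally show ?thesis .
  qed
  note pos_b = assms(7)[rule_format] and pos_c = assms(9)[rule_format]
  show ?thesis
  proof
    assume ?frame
    then obtain x where op: "is_frame_operator {1..k} x B"
      and norms: "\<And>i. i \<in> {1..k} \<Longrightarrow> vnorm (x i) = sqrt (c i)" by blast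
    have Bx: "B y = (\<Sum>i=1..k. scale (ip y (x i)) (x i))" for y
      using op is_frame_operator_finite[of "{1..k}" x B] by simp
    show ?maj
    proof (intro allI impI)
      fix p assume p: "1 \<le> p \<and> p \<le> n - 1"
      then have "(\<Sum>i=1..p. (vnorm (x i))\<^sup>2) \<le> (\<Sum>i=1..p. b i)"
        by (intro frame_norms_prefix_le[OF e expand lin eig assms(6) pos_b Bx _ _ assms(8)]) auto
      moreover have "(\<Sum>i=1..p. (vnorm (x i))\<^sup>2) = (\<Sum>i=1..p. c i)"
        using norms pos_c p assms(8) by (intro sum.cong) (auto intro!: less_imp_le)
      ultimately show "(\<Sum>i=1..p. c i) \<le> (\<Sum>i=1..p. b i)" by simp
    qed
  next
    assume ?maj
    then obtain x where norms: "\<And>i. i \<in> {1..k} \<Longrightarrow> (vnorm (x i))\<^sup>2 = c i"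
      and Bx: "\<And>y. B y = (\<Sum>i=1..k. scale (ip y (x i)) (x i))"
      using prescribed_norms_of_operator[OF e Be assms(6) pos_b assms(10) pos_c assms(8,11)]
      by blast
    have "is_frame {1..k} x"
      by (rule is_frame_of_diagonal_operator[OF expand Be pos_b _ Bx]) auto
    moreover have "is_frame_operator {1..k} x B"
      using Bx is_frame_operator_finite[of "{1..k}" x B] by simp
    moreover have "vnorm (x i) = sqrt (c i)" if "i \<in> {1..k}" for i
      using norms[OF that] vnorm_nonneg[of "x i"] by (simp add: real_sqrt_unique)
    ultimately show ?frame by blast
  qed
qed

end
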